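(* Let $p>q$ be two co-prime positive integers and put $c=\frac{pq}{2(p-q)}$. Then $$S(\mu,\theta)=\left(\cosh\mu\,\sqrt{q}\,e^{ip\theta},\ i\sinh\mu\,\sqrt{p}\,e^{-iq\theta}\right),\qquad 0\le\theta<2\pi,\ \mu\in\mathbb{R},$$ is a Hamiltonian stationary (Lagrangian) self-shrinker in $\mathbb{C}^2$, and $$E(\mu,\theta)=\left(\sinh\mu\,\sqrt{q}\,e^{ip\theta},\ i\cosh\mu\,\sqrt{p}\,e^{-iq\theta}\right),\qquad 0\le\theta<2\pi,\ \mu\in\mathbb{R},$$ is a Hamiltonian stationary (Lagrangian) self-expander in $\mathbb{C}^2$. Moreover $S$ satisfies $F^\perp=-2cH$, while $E$ satisfies $F^\perp=2cH$, where $F$ denotes the position vector.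
   Context: $\mathbb{C}^2$ has coordinates $z^j=x^j+\sqrt{-1}\,y^j$, the Euclidean metric, symplectic form $\omega=\sum_j dx^j\wedge dy^j$, and complex structure $J$ with $J\partial_{x^j}=\partial_{y^j}$. The parameter $\theta$ is understood modulo $2\pi$, and submanifolds are immersed. For a Lagrangian submanifold $\Sigma$, the Lagrangian angle $\beta$ is defined by $*_\Sigma(dz^1\wedge dz^2)=e^{i\beta}$, where $*_\Sigma$ is the Hodge star operator of $\Sigma$; the mean curvature vector is $H=J\nabla\beta$. $\Sigma$ is Hamiltonian stationary if $\Delta\beta=0$, with $\Delta$ the Laplacian of $\Sigma$. $\Sigma$ is self-similar if $F^\perp=2aH$ for some constant $a$, where $F^\perp$ is the normal projection of the position vector $F$; it is a self-shrinker if $a<0$ and a self-expander if $a>0$. *)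

theory Defs
  imports "HOL-Analysis.Analysis"
begin

section \<open>The flat Kaehler structure of \<open>\<complex>\<^sup>2\<close>\<close>

text \<open>The Euclidean metric of \<open>\<complex>\<^sup>2 = \<real>\<^sup>4\<close> is the library inner product on \<^typ>\<open>complex \<times> complex\<close>,
  regarded as a real vector space.\<close>

type_synonym C2 = "complex \<times> complex"

definition cplx_J :: "C2 \<Rightarrow> C2" where
  "cplx_J v = (\<i> * fst v, \<i> * snd v)"

definition symp_form :: "C2 \<Rightarrow> C2 \<Rightarrow> real" where
  "symp_form u v = (Re (fst u) * Im (fst v) - Im (fst u) * Re (fst v))
                 + (Re (snd u) * Im (snd v) - Im (snd u) * Re (snd v))"

definition dz1_dz2 :: "C2 \<Rightarrow> C2 \<Rightarrow> complex" where
  "dz1_dz2 u v = fst u * snd v - snd u * fst v"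


section \<open>Smooth maps\<close>

primrec Ck :: "nat \<Rightarrow> ('a::real_normed_vector \<Rightarrow> 'b::real_normed_vector) \<Rightarrow> bool" where
  "Ck 0 f \<longleftrightarrow> continuous_on UNIV f"
| "Ck (Suc k) f \<longleftrightarrow> f differentiable_on UNIV \<and> (\<forall>v. Ck k (\<lambda>x. frechet_derivative f (at x) v))"

definition smooth :: "('a::real_normed_vector \<Rightarrow> 'b::real_normed_vector) \<Rightarrow> bool" where
  "smooth f \<longleftrightarrow> (\<forall>k. Ck k f)"


section \<open>Immersed cylinders in \<open>\<complex>\<^sup>2\<close>\<close>

text \<open>A surface with parameters \<open>\<mu> \<in> \<real>\<close> and \<open>\<theta> \<in> \<real>/2\<pi>\<int>\<close> is given by its lift to the universal cover
  \<open>\<real>\<^sup>2\<close> of the cylinder, that is, by a map which is \<open>2\<pi>\<close>-periodic in the second variable. It is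
  oriented by \<open>(\<partial>\<^sub>\<mu>, \<partial>\<^sub>\<theta>)\<close>.\<close>

type_synonym param = "real \<times> real"

definition immersed_cylinder :: "(param \<Rightarrow> C2) \<Rightarrow> bool" where
  "immersed_cylinder F \<longleftrightarrow> smooth F
     \<and> (\<forall>\<mu> \<theta>. F (\<mu>, \<theta> + 2 * pi) = F (\<mu>, \<theta>))
     \<and> (\<forall>x. inj (frechet_derivative F (at x)))"

definition d_mu :: "(param \<Rightarrow> 'b::real_normed_vector) \<Rightarrow> param \<Rightarrow> 'b" where
  "d_mu f x = frechet_derivative f (at x) (1, 0)"

definition d_theta :: "(param \<Rightarrow> 'b::real_normed_vector) \<Rightarrow> param \<Rightarrow> 'b" where
  "d_theta f x = frechet_derivative f (at x) (0, 1)"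

definition tangent_plane :: "(param \<Rightarrow> C2) \<Rightarrow> param \<Rightarrow> C2 set" where
  "tangent_plane F x = range (frechet_derivative F (at x))"

definition normal_proj :: "(param \<Rightarrow> C2) \<Rightarrow> param \<Rightarrow> C2 \<Rightarrow> C2" where
  "normal_proj F x v = (THE n. n \<in> orthogonal_comp (tangent_plane F x) \<and> v - n \<in> tangent_plane F x)"

text \<open>Coefficients and area density of the first fundamental form.\<close>

definition g11 :: "(param \<Rightarrow> C2) \<Rightarrow> param \<Rightarrow> real" where
  "g11 F x = d_mu F x \<bullet> d_mu F x"

definition g12 :: "(param \<Rightarrow> C2) \<Rightarrow> param \<Rightarrow> real" where
  "g12 F x = d_mu F x \<bullet> d_theta F x"

definition g22 :: "(param \<Rightarrow> C2) \<Rightarrow> param \<Rightarrow> real" where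
  "g22 F x = d_theta F x \<bullet> d_theta F x"

definition area_density :: "(param \<Rightarrow> C2) \<Rightarrow> param \<Rightarrow> real" where
  "area_density F x = sqrt (g11 F x * g22 F x - (g12 F x)\<^sup>2)"

text \<open>The Hodge star of the restriction of a 2-form \<open>\<alpha>\<close> of the ambient space to the oriented surface.\<close>

definition hodge_star :: "(param \<Rightarrow> C2) \<Rightarrow> (C2 \<Rightarrow> C2 \<Rightarrow> complex) \<Rightarrow> param \<Rightarrow> complex" where
  "hodge_star F \<alpha> x = \<alpha> (d_mu F x) (d_theta F x) / of_real (area_density F x)"

text \<open>The gradient of a function on the surface, as a tangent vector in \<open>\<complex>\<^sup>2\<close>.\<close>

definition surf_grad :: "(param \<Rightarrow> C2) \<Rightarrow> (param \<Rightarrow> real) \<Rightarrow> param \<Rightarrow> C2" where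
  "surf_grad F f x = (THE t. t \<in> tangent_plane F x \<and>
     (\<forall>v. t \<bullet> frechet_derivative F (at x) v = frechet_derivative f (at x) v))"

text \<open>The Laplace-Beltrami operator
  \<open>\<Delta>f = (1/\<surd>g) \<Sum>\<^sub>i\<^sub>j \<partial>\<^sub>i (\<surd>g g\<^sup>i\<^sup>j \<partial>\<^sub>j f)\<close>, where \<open>(g\<^sup>i\<^sup>j)\<close> is the inverse of \<open>(g\<^sub>i\<^sub>j)\<close>; since
  \<open>g = det (g\<^sub>i\<^sub>j)\<close>, one has \<open>\<surd>g g\<^sup>1\<^sup>1 = g\<^sub>2\<^sub>2/\<surd>g\<close> and so on.\<close>

definition surf_laplacian :: "(param \<Rightarrow> C2) \<Rightarrow> (param \<Rightarrow> real) \<Rightarrow> param \<Rightarrow> real" where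
  "surf_laplacian F f x =
     (d_mu (\<lambda>y. (g22 F y * d_mu f y - g12 F y * d_theta f y) / area_density F y) x
      + d_theta (\<lambda>y. (g11 F y * d_theta f y - g12 F y * d_mu f y) / area_density F y) x)
     / area_density F x"


section \<open>Lagrangian surfaces, the Lagrangian angle and mean curvature\<close>

definition lagrangian :: "(param \<Rightarrow> C2) \<Rightarrow> bool" where
  "lagrangian F \<longleftrightarrow> immersed_cylinder F \<and>
     (\<forall>x u v. symp_form (frechet_derivative F (at x) u) (frechet_derivative F (at x) v) = 0)"

text \<open>The Lagrangian angle takes values in \<open>\<real>/2\<pi>\<int>\<close>. On the universal cover it has a smooth real-valued
  lift, which need not be periodic in \<open>\<theta>\<close> and is unique up to an additive constant in \<open>2\<pi>\<int>\<close> (lemma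
  \<open>is_lagrangian_angle_unique\<close> below). The gradient and Laplacian do not depend on the lift.\<close>

definition is_lagrangian_angle :: "(param \<Rightarrow> C2) \<Rightarrow> (param \<Rightarrow> real) \<Rightarrow> bool" where
  "is_lagrangian_angle F \<beta> \<longleftrightarrow> smooth \<beta> \<and> (\<forall>x. hodge_star F dz1_dz2 x = exp (\<i> * of_real (\<beta> x)))"

definition lagrangian_angle :: "(param \<Rightarrow> C2) \<Rightarrow> param \<Rightarrow> real" where
  "lagrangian_angle F = (SOME \<beta>. is_lagrangian_angle F \<beta>)"

lemma is_lagrangian_angle_unique:
  assumes "is_lagrangian_angle F \<beta>" "is_lagrangian_angle F \<gamma>"
  shows "\<exists>k::int. \<forall>x. \<beta> x = \<gamma> x + 2 * pi * of_int k"
proof -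
  define h where "h = (\<lambda>x. (\<beta> x - \<gamma> x) / (2 * pi))"
  have "Ck 0 \<beta>" "Ck 0 \<gamma>"
    using assms unfolding is_lagrangian_angle_def smooth_def by blast+
  then have c: "continuous_on UNIV h"
    unfolding h_def by (auto intro!: continuous_intros)
  have "\<exists>k::int. h x = of_int k" for x
  proof -
    have "exp (\<i> * of_real (\<beta> x)) = exp (\<i> * of_real (\<gamma> x))"
      using assms[unfolded is_lagrangian_angle_def, THEN conjunct2, THEN spec, of x] by (rule trans[OF sym])
    then obtain k :: int where "\<i> * of_real (\<beta> x) = \<i> * of_real (\<gamma> x) + (of_int (2 * k) * pi) * \<i>"
      unfolding exp_eq by blast
    then have "Im (\<i> * of_real (\<beta> x)) = Im (\<i> * of_real (\<gamma> x) + (of_int (2 * k) * pi) * \<i>)"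
      by (rule arg_cong)
    then have "\<beta> x = \<gamma> x + 2 * of_int k * pi" by simp
    then show ?thesis by (auto simp: h_def)
  qed
  then have Z: "h x \<in> \<int>" for x unfolding Ints_def by blast
  have "h constant_on UNIV"
  proof (rule continuous_discrete_range_constant[OF connected_UNIV c])
    fix x :: param
    have "1 \<le> norm (h y - h x)" if "h y \<noteq> h x" for y
      using Ints_nonzero_abs_ge1[OF Ints_diff[OF Z[of y] Z[of x]]] that by simp
    then show "\<exists>e>0. \<forall>y. y \<in> UNIV \<and> h y \<noteq> h x \<longrightarrow> e \<le> norm (h y - h x)"
      by (intro exI[of _ 1]) auto
  qed
  then obtain a where a: "\<And>x. h x = a" by (auto simp: constant_on_def)
  then have "a \<in> \<int>" using Z[of undefined] by simp
  then obtain k :: int where "a = of_int k" by (rule Ints_cases)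
  with a have "\<beta> x = \<gamma> x + 2 * pi * of_int k" for x
    using a[of x] by (simp add: h_def field_simps)
  then show ?thesis by blast
qed

definition mean_curvature :: "(param \<Rightarrow> C2) \<Rightarrow> param \<Rightarrow> C2" where
  "mean_curvature F x = cplx_J (surf_grad F (lagrangian_angle F) x)"

text \<open>The second conjunct below says that a smooth angle exists, so that the choice in
  \<^const>\<open>lagrangian_angle\<close> is meaningful.\<close>

definition hamiltonian_stationary :: "(param \<Rightarrow> C2) \<Rightarrow> bool" where
  "hamiltonian_stationary F \<longleftrightarrow> lagrangian F
     \<and> is_lagrangian_angle F (lagrangian_angle F)
     \<and> (\<forall>x. surf_laplacian F (lagrangian_angle F) x = 0)"

definition self_similar :: "(param \<Rightarrow> C2) \<Rightarrow> real \<Rightarrow> bool" where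
  "self_similar F a \<longleftrightarrow> lagrangian F \<and>
     (\<forall>x. normal_proj F x (F x) = (2 * a) *\<^sub>R mean_curvature F x)"

definition self_shrinker :: "(param \<Rightarrow> C2) \<Rightarrow> bool" where
  "self_shrinker F \<longleftrightarrow> (\<exists>a<0. self_similar F a)"

definition self_expander :: "(param \<Rightarrow> C2) \<Rightarrow> bool" where
  "self_expander F \<longleftrightarrow> (\<exists>a>0. self_similar F a)"

end

theory Submission
  imports Defs
begin

text \<open>Both surfaces have the form
  \<open>F (\<mu>, \<theta>) = (f \<mu> \<surd>q e\<^sup>i\<^sup>p\<^sup>\<theta>, \<i> g \<mu> \<surd>p e\<^sup>-\<^sup>i\<^sup>q\<^sup>\<theta>)\<close> with \<open>f' = g\<close> and \<open>g' = f\<close>, so that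
  \<open>\<epsilon> = f\<^sup>2 - g\<^sup>2\<close> is constant: \<open>f = cosh\<close>, \<open>g = sinh\<close>, \<open>\<epsilon> = 1\<close> for \<open>S\<close>, and the roles of \<open>f\<close>
  and \<open>g\<close> exchanged with \<open>\<epsilon> = -1\<close> for \<open>E\<close>. One computation therefore serves for both.

  Put \<open>W = p f\<^sup>2 + q g\<^sup>2\<close>, which is positive because \<open>\<epsilon> \<noteq> 0\<close> prevents \<open>f\<close> and \<open>g\<close> from vanishing
  together. The vectors \<open>F\<^sub>\<mu>\<close>, \<open>F\<^sub>\<theta>\<close>, \<open>J F\<^sub>\<mu>\<close>, \<open>J F\<^sub>\<theta>\<close> are mutually orthogonal, with
  \<open>|F\<^sub>\<mu>|\<^sup>2 = W\<close> and \<open>|F\<^sub>\<theta>|\<^sup>2 = p q W\<close> (\<open>inner_frame\<close>). Hence \<open>F\<close> is a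
  Lagrangian immersion, and after rescaling \<open>\<theta>\<close> by \<open>\<surd>(pq)\<close> it is conformal. Since
  \<open>(dz\<^sup>1 \<and> dz\<^sup>2) (F\<^sub>\<mu>, F\<^sub>\<theta>) = \<surd>(pq) W e\<^sup>i\<^sup>(\<^sup>p\<^sup>-\<^sup>q\<^sup>)\<^sup>\<theta>\<close>, the Lagrangian angle is \<open>(p - q) \<theta>\<close>
  (\<open>is_lagrangian_angle_F\<close>). It is linear in the parameters, and a linear function is harmonic for
  a metric of this shape, so \<open>F\<close> is Hamiltonian stationary (\<open>hamiltonian_stationary_F\<close>).

  The gradient of the angle is \<open>(p - q) / (p q W) F\<^sub>\<theta>\<close>, so \<open>H = (p - q) / (p q W) J F\<^sub>\<theta>\<close>
  (\<open>mean_curvature_F\<close>). The position vector is orthogonal to \<open>J F\<^sub>\<mu>\<close> and has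
  inner product \<open>-p q \<epsilon>\<close> with \<open>J F\<^sub>\<theta>\<close>, so its normal part is \<open>-(\<epsilon> / W) J F\<^sub>\<theta>\<close> (\<open>normal_proj_position\<close>). Comparing
  the two gives \<open>F\<^sup>\<bottom> = -\<epsilon> (p q / (p - q)) H = -2 \<epsilon> c H\<close>.\<close>


section \<open>Smoothness, normal projection and gradient\<close>

text \<open>Smoothness of explicitly given functions follows from a differential-algebra argument: it is
  enough to place the function in some family that directional derivatives do not leave.\<close>

lemma smooth_if_closed_under_derivatives:
  assumes "f \<in> \<F>"
    and diff: "\<And>h x. h \<in> \<F> \<Longrightarrow> h differentiable (at x)"
    and closed: "\<And>h v. h \<in> \<F> \<Longrightarrow> (\<lambda>x. frechet_derivative h (at x) v) \<in> \<F>"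
  shows "smooth f"
proof -
  have "\<forall>h\<in>\<F>. Ck k h" for k
  proof (induction k)
    case 0
    show ?case
      using diff by (auto intro!: differentiable_imp_continuous_on simp: differentiable_on_def)
  next
    case (Suc k)
    then show ?case
      using diff closed by (auto simp: differentiable_on_def)
  qed
  then show ?thesis
    using assms(1) unfolding smooth_def by blast
qed

lemma smooth_bounded_linear:
  assumes "bounded_linear l"
  shows "smooth l"
proof (rule smooth_if_closed_under_derivatives)
  show "l \<in> {l} \<union> range (\<lambda>c _. c)" by simp
next
  fix h x assume "h \<in> {l} \<union> range (\<lambda>c _. c)"
  then show "h differentiable (at x)"
    using bounded_linear_imp_differentiable[OF assms] by auto
next
  fix h v assume "h \<in> {l} \<union> range (\<lambda>c _. c)"
  then show "(\<lambda>x. frechet_derivative h (at x) v) \<in> {l} \<union> range (\<lambda>c _. c)"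
    using frechet_derivative_at[OF bounded_linear_imp_has_derivative[OF assms]]
    by (auto simp flip: fun_eq_iff)
qed

lemma subspace_tangent_plane:
  assumes "F differentiable (at x)"
  shows "subspace (tangent_plane F x)"
  unfolding tangent_plane_def
  using assms by (intro linear_subspace_image linear_frechet_derivative subspace_UNIV)

lemma normal_proj_eqI:
  assumes "F differentiable (at x)"
    and n: "n \<in> orthogonal_comp (tangent_plane F x)" "v - n \<in> tangent_plane F x"
  shows "normal_proj F x v = n"
  unfolding normal_proj_def
proof (rule the_equality)
  fix m
  assume m: "m \<in> orthogonal_comp (tangent_plane F x) \<and> v - m \<in> tangent_plane F x"
  have "(v - n) - (v - m) \<in> tangent_plane F x"
    using subspace_diff[OF subspace_tangent_plane[OF assms(1)]] n m by blast
  then have T: "m - n \<in> tangent_plane F x" by simp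
  have "m - n \<in> orthogonal_comp (tangent_plane F x)"
    using subspace_diff[OF subspace_orthogonal_comp] n m by blast
  with T have "orthogonal (m - n) (m - n)"
    unfolding orthogonal_comp_def by blast
  then show "m = n"
    by (simp add: orthogonal_def)
qed (use n in blast)

lemma surf_grad_eqI:
  assumes "F differentiable (at x)"
    and t: "t \<in> tangent_plane F x"
      "\<And>v. t \<bullet> frechet_derivative F (at x) v = frechet_derivative f (at x) v"
  shows "surf_grad F f x = t"
  unfolding surf_grad_def
proof (rule the_equality)
  fix s
  assume s: "s \<in> tangent_plane F x \<and>
    (\<forall>v. s \<bullet> frechet_derivative F (at x) v = frechet_derivative f (at x) v)"
  have "s - t \<in> tangent_plane F x"
    using subspace_diff[OF subspace_tangent_plane[OF assms(1)]] s t by blast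
  then obtain v where v: "s - t = frechet_derivative F (at x) v"
    unfolding tangent_plane_def by blast
  have "(s - t) \<bullet> frechet_derivative F (at x) v = 0"
    using s[THEN conjunct2, THEN spec, of v] t(2)[of v] unfolding inner_diff_left by simp
  then show "s = t"
    by (simp flip: v)
qed (use t in blast)

lemma symp_form_eq_inner: "symp_form u v = cplx_J u \<bullet> v"
  by (simp add: symp_form_def cplx_J_def inner_prod_def inner_complex_def)

lemma inner_mult_cis: "(z * cis t) \<bullet> (w * cis t) = z \<bullet> w"
proof -
  have "(z * cis t) \<bullet> (w * cis t) = (z \<bullet> w) * ((cos t)\<^sup>2 + (sin t)\<^sup>2)"
    unfolding inner_complex_def
    by (simp add: power2_eq_square algebra_simps del: sin_cos_squared_add2 sin_cos_squared_add3)
  then show ?thesis by simp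
qed


section \<open>Cylinders over a hyperbola\<close>

locale hyperbolic_cylinder =
  fixes p q :: nat and f g :: "real \<Rightarrow> real" and \<epsilon> :: real
  assumes p_pos: "0 < p" and q_pos: "0 < q"
    and f_deriv: "\<And>t. (f has_real_derivative g t) (at t)"
    and g_deriv: "\<And>t. (g has_real_derivative f t) (at t)"
    and hyperbola: "\<And>t. (f t)\<^sup>2 - (g t)\<^sup>2 = \<epsilon>"
    and eps_nonzero: "\<epsilon> \<noteq> 0"
begin

text \<open>The coordinates of \<open>F\<close> and of all its iterated derivatives are of this form; differentiation
  acts on the coefficients \<open>a\<close> and \<open>b\<close> alone.\<close>

definition wave :: "real \<Rightarrow> complex \<Rightarrow> complex \<Rightarrow> param \<Rightarrow> complex" where
  "wave m a b x = (a * of_real (f (fst x)) + b * of_real (g (fst x))) * cis (m * snd x)"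

definition F :: "param \<Rightarrow> C2" where
  "F x = (wave p (sqrt q) 0 x, wave (- real q) 0 (\<i> * sqrt p) x)"

definition F_mu :: "param \<Rightarrow> C2" where
  "F_mu x = (wave p 0 (sqrt q) x, wave (- real q) (\<i> * sqrt p) 0 x)"

definition F_theta :: "param \<Rightarrow> C2" where
  "F_theta x = (wave p (\<i> * p * sqrt q) 0 x, wave (- real q) 0 (q * sqrt p) x)"

definition W :: "param \<Rightarrow> real" where
  "W x = p * (f (fst x))\<^sup>2 + q * (g (fst x))\<^sup>2"

lemma W_pos: "0 < W x"
proof -
  have "f (fst x) \<noteq> 0 \<or> g (fst x) \<noteq> 0"
    using hyperbola[of "fst x"] eps_nonzero by auto
  then show ?thesis
    unfolding W_def using p_pos q_pos by (auto intro: add_pos_nonneg add_nonneg_pos)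
qed

lemma wave_has_derivative:
  "(wave m a b has_derivative
     (\<lambda>v. wave m (of_real (fst v) * b + \<i> * of_real (m * snd v) * a)
                 (of_real (fst v) * a + \<i> * of_real (m * snd v) * b) x)) (at x)"
proof -
  have f: "((\<lambda>y. f (fst y)) has_derivative (\<lambda>v. fst v * g (fst x))) (at x)"
    using has_derivative_compose[OF has_derivative_fst[OF has_derivative_ident]
        f_deriv[unfolded has_field_derivative_def, of "fst x"]]
    by (simp add: mult.commute)
  have g: "((\<lambda>y. g (fst y)) has_derivative (\<lambda>v. fst v * f (fst x))) (at x)"
    using has_derivative_compose[OF has_derivative_fst[OF has_derivative_ident]
        g_deriv[unfolded has_field_derivative_def, of "fst x"]]
    by (simp add: mult.commute)
  have e: "((\<lambda>y. cis (m * snd y)) has_derivative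
      (\<lambda>v. (m * snd v) *\<^sub>R (\<i> * cis (m * snd x)))) (at x)"
    by (auto intro!: derivative_eq_intros)
  show ?thesis
    unfolding wave_def
    by (rule has_derivative_eq_rhs,
        rule has_derivative_mult[OF has_derivative_add[OF
          has_derivative_mult_right[OF has_derivative_of_real[OF f]]
          has_derivative_mult_right[OF has_derivative_of_real[OF g]]] e])
      (simp add: fun_eq_iff scaleR_conv_of_real algebra_simps)
qed

lemma wave_pair_derivative:
  "((\<lambda>x. (wave m a b x, wave n a' b' x)) has_derivative
     (\<lambda>v. (wave m (of_real (fst v) * b + \<i> * of_real (m * snd v) * a)
                  (of_real (fst v) * a + \<i> * of_real (m * snd v) * b) x,
           wave n (of_real (fst v) * b' + \<i> * of_real (n * snd v) * a')
                  (of_real (fst v) * a' + \<i> * of_real (n * snd v) * b') x))) (at x)"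
  by (intro has_derivative_Pair wave_has_derivative)

lemma smooth_wave_pair: "smooth (\<lambda>x. (wave m a b x, wave n a' b' x))"
proof (rule smooth_if_closed_under_derivatives)
  let ?\<F> = "{h. \<exists>a b a' b'. h = (\<lambda>x. (wave m a b x, wave n a' b' x))}"
  show "(\<lambda>x. (wave m a b x, wave n a' b' x)) \<in> ?\<F>"
    by blast
  show "h differentiable (at x)" if "h \<in> ?\<F>" for h x
    using that wave_pair_derivative differentiableI by blast
  show "(\<lambda>x. frechet_derivative h (at x) v) \<in> ?\<F>" if "h \<in> ?\<F>" for h v
  proof -
    from that obtain a b a' b' where h: "h = (\<lambda>x. (wave m a b x, wave n a' b' x))"
      by blast
    show ?thesis
      unfolding h frechet_derivative_at[OF wave_pair_derivative, symmetric] by blast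
  qed
qed

lemma smooth_F: "smooth F"
  using smooth_wave_pair[of p "sqrt q" 0 "- real q" 0 "\<i> * sqrt p"]
  by (simp add: F_def[abs_def])

lemma F_has_derivative: "(F has_derivative (\<lambda>v. fst v *\<^sub>R F_mu x + snd v *\<^sub>R F_theta x)) (at x)"
  unfolding F_def[abs_def]
  by (rule has_derivative_eq_rhs, rule wave_pair_derivative)
    (simp add: fun_eq_iff F_mu_def F_theta_def wave_def scaleR_conv_of_real algebra_simps)

lemma F_differentiable: "F differentiable (at x)"
  using F_has_derivative differentiableI by blast

lemma frechet_derivative_F:
  "frechet_derivative F (at x) v = fst v *\<^sub>R F_mu x + snd v *\<^sub>R F_theta x"
  using frechet_derivative_at[OF F_has_derivative] by metis

lemma F_periodic: "F (\<mu>, \<theta> + 2 * pi) = F (\<mu>, \<theta>)"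
proof -
  have "cis (r * (\<theta> + 2 * pi)) = cis (r * \<theta>)" if "r \<in> \<int>" for r
    using cis_multiple_2pi[OF that] by (simp add: distrib_left mult_ac flip: cis_mult)
  from this[of p] this[of "- real q"] show ?thesis
    unfolding F_def wave_def by simp
qed


section \<open>Metric, Lagrangian property and Lagrangian angle\<close>

text \<open>The common phase of two waves of equal frequency drops out of their inner product, so each
  identity below is polynomial in \<open>f\<close> and \<open>g\<close>.\<close>

lemma inner_wave:
  "wave m a b x \<bullet> wave m a' b' x =
   (a * of_real (f (fst x)) + b * of_real (g (fst x))) \<bullet>
   (a' * of_real (f (fst x)) + b' * of_real (g (fst x)))"
  unfolding wave_def by (rule inner_mult_cis)

lemma ii_wave: "\<i> * wave m a b x = wave m (\<i> * a) (\<i> * b) x"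
  by (simp add: wave_def algebra_simps)

lemmas inner_frame_simps =
  F_mu_def F_theta_def cplx_J_def inner_prod_def ii_wave inner_wave

lemma inner_frame:
  shows "F_mu x \<bullet> F_mu x = W x"
    and "F_theta x \<bullet> F_theta x = real p * real q * W x"
    and "F_mu x \<bullet> F_theta x = 0"
    and "cplx_J (F_mu x) \<bullet> F_theta x = 0"
proof -
  have sq: "sqrt p * (sqrt p * t) = p * t" "sqrt q * (sqrt q * t) = q * t" for t :: real
    by (simp_all flip: mult.assoc)
  show "F_mu x \<bullet> F_mu x = W x"
    unfolding inner_frame_simps fst_conv snd_conv
    by (simp add: inner_complex_def W_def power2_eq_square sq algebra_simps)
  show "F_theta x \<bullet> F_theta x = real p * real q * W x"
    unfolding inner_frame_simps fst_conv snd_conv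
    by (simp add: inner_complex_def W_def power2_eq_square sq algebra_simps)
  show "F_mu x \<bullet> F_theta x = 0"
    unfolding inner_frame_simps fst_conv snd_conv by (simp add: inner_complex_def)
  show "cplx_J (F_mu x) \<bullet> F_theta x = 0"
    unfolding inner_frame_simps fst_conv snd_conv
    by (simp add: inner_complex_def sq algebra_simps)
qed

lemma d_F: "d_mu F x = F_mu x" "d_theta F x = F_theta x"
  by (simp_all add: d_mu_def d_theta_def frechet_derivative_F)

lemma first_fundamental_form:
  shows "g11 F x = W x" and "g12 F x = 0" and "g22 F x = real p * real q * W x"
  by (simp_all add: g11_def g12_def g22_def d_F inner_frame)

lemma area_density_F: "area_density F x = sqrt (real p * real q) * W x"
proof -
  have "area_density F x = sqrt (real p * real q * (W x)\<^sup>2)"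
    by (simp add: area_density_def first_fundamental_form power2_eq_square mult_ac)
  then show ?thesis
    using W_pos[of x] by (simp add: real_sqrt_mult)
qed

lemma inj_frechet_derivative_F: "inj (frechet_derivative F (at x))"
proof -
  have "v = 0" if v: "frechet_derivative F (at x) v = 0" for v
  proof -
    have "F_mu x \<bullet> frechet_derivative F (at x) v = fst v * W x"
      "F_theta x \<bullet> frechet_derivative F (at x) v = snd v * (real p * real q * W x)"
      using inner_frame(3)[of x]
      by (simp_all add: frechet_derivative_F inner_add_right inner_frame inner_commute)
    then show ?thesis
      using v W_pos[of x] p_pos q_pos by (simp add: prod_eq_iff)
  qed
  then show ?thesis
    using linear_injective_0[OF linear_frechet_derivative[OF F_differentiable]] by blast
qed

lemma symp_form_F:
  "symp_form (frechet_derivative F (at x) u) (frechet_derivative F (at x) v) = 0"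
proof -
  have "symp_form (a *\<^sub>R s + b *\<^sub>R t) (c *\<^sub>R s + d *\<^sub>R t) = (a * d - b * c) * symp_form s t"
    for a b c d s t
    by (simp add: symp_form_def algebra_simps)
  then show ?thesis
    using inner_frame(4)[of x] by (simp add: frechet_derivative_F symp_form_eq_inner)
qed

lemma lagrangian_F: "lagrangian F"
  unfolding lagrangian_def immersed_cylinder_def
  using smooth_F F_periodic inj_frechet_derivative_F symp_form_F by blast

lemma dz1_dz2_frame:
  "dz1_dz2 (F_mu x) (F_theta x) =
     of_real (sqrt (real p * real q) * W x) * exp (\<i> * of_real ((real p - real q) * snd x))"
proof -
  have phase: "exp (\<i> * of_real ((real p - real q) * snd x))
      = cis (p * snd x) * cis (- real q * snd x)"
    unfolding cis_conv_exp[symmetric] cis_mult by (simp add: left_diff_distrib)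
  show ?thesis
    unfolding phase
    by (simp add: dz1_dz2_def F_mu_def F_theta_def wave_def W_def real_sqrt_mult
        power2_eq_square algebra_simps)
qed

lemma is_lagrangian_angle_F: "is_lagrangian_angle F (\<lambda>x. (real p - real q) * snd x)"
  unfolding is_lagrangian_angle_def
proof
  show "smooth (\<lambda>x::param. (real p - real q) * snd x)"
    by (intro smooth_bounded_linear bounded_linear_mult_right[THEN bounded_linear_compose]
        bounded_linear_snd)
  show "\<forall>x. hodge_star F dz1_dz2 x = exp (\<i> * of_real ((real p - real q) * snd x))"
    using W_pos p_pos q_pos
    by (simp add: hodge_star_def d_F area_density_F dz1_dz2_frame less_imp_neq[symmetric])
qed


section \<open>Curvature and self-similarity\<close>

lemma is_lagrangian_angle_lagrangian_angle: "is_lagrangian_angle F (lagrangian_angle F)"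
  unfolding lagrangian_angle_def
  by (rule someI[where P = "is_lagrangian_angle F", OF is_lagrangian_angle_F])

lemma frechet_derivative_lagrangian_angle:
  "frechet_derivative (lagrangian_angle F) (at x) v = (real p - real q) * snd v"
proof -
  \<comment> \<open>The chosen angle is known only up to an additive constant, which differentiation removes.\<close>
  obtain k :: int where "\<And>x. lagrangian_angle F x = (real p - real q) * snd x + 2 * pi * of_int k"
    using is_lagrangian_angle_unique[OF is_lagrangian_angle_lagrangian_angle is_lagrangian_angle_F]
    by blast
  then have "lagrangian_angle F = (\<lambda>x. (real p - real q) * snd x + 2 * pi * of_int k)"
    by blast
  moreover have "((\<lambda>x::param. (real p - real q) * snd x + 2 * pi * of_int k) has_derivative
      (\<lambda>v. (real p - real q) * snd v)) (at x)"
    by (auto intro!: derivative_eq_intros)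
  ultimately show ?thesis
    using frechet_derivative_at by metis
qed

text \<open>In the divergence form of the Laplacian the \<open>\<theta>\<close>-flux of the angle is \<open>(p - q) g\<^sub>1\<^sub>1\<close> divided by
  the area density, in which \<open>W\<close> cancels; the \<open>\<mu>\<close>-flux vanishes.\<close>

lemma hamiltonian_stationary_F: "hamiltonian_stationary F"
proof -
  have dbeta: "d_mu (lagrangian_angle F) y = 0" "d_theta (lagrangian_angle F) y = real p - real q"
    for y
    by (simp_all add: d_mu_def d_theta_def frechet_derivative_lagrangian_angle)
  have "W y * (real p - real q) / (sqrt (real p * real q) * W y)
      = (real p - real q) / sqrt (real p * real q)" for y
    using W_pos[of y] by simp
  then have "surf_laplacian F (lagrangian_angle F) x = 0" for x
    unfolding surf_laplacian_def dbeta first_fundamental_form area_density_F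
    by (simp add: d_mu_def d_theta_def)
  then show ?thesis
    unfolding hamiltonian_stationary_def
    using lagrangian_F is_lagrangian_angle_lagrangian_angle by blast
qed

lemma mean_curvature_F:
  "mean_curvature F x = ((real p - real q) / (real p * real q * W x)) *\<^sub>R cplx_J (F_theta x)"
proof -
  let ?k = "(real p - real q) / (real p * real q * W x)"
  have "surf_grad F (lagrangian_angle F) x = ?k *\<^sub>R F_theta x"
  proof (rule surf_grad_eqI[OF F_differentiable])
    have "?k *\<^sub>R F_theta x = frechet_derivative F (at x) (0, ?k)"
      by (simp add: frechet_derivative_F)
    then show "?k *\<^sub>R F_theta x \<in> tangent_plane F x"
      unfolding tangent_plane_def by blast
    show "?k *\<^sub>R F_theta x \<bullet> frechet_derivative F (at x) v
        = frechet_derivative (lagrangian_angle F) (at x) v" for v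
      using inner_frame(3)[of x] W_pos[of x] p_pos q_pos
      by (simp add: frechet_derivative_F frechet_derivative_lagrangian_angle inner_add_right
          inner_frame inner_commute)
  qed
  then show ?thesis
    by (simp add: mean_curvature_def cplx_J_def)
qed

text \<open>Besides the normal part \<open>-(\<epsilon> / W) J F\<^sub>\<theta>\<close>, the position vector has the tangential part
  \<open>(F \<bullet> F\<^sub>\<mu>) / |F\<^sub>\<mu>|\<^sup>2 F\<^sub>\<mu>\<close> only, since \<open>F\<close> is orthogonal to the rotational direction \<open>F\<^sub>\<theta>\<close>.\<close>

lemma position_decomposition:
  "W x *\<^sub>R F x + \<epsilon> *\<^sub>R cplx_J (F_theta x)
     = ((real p + real q) * f (fst x) * g (fst x)) *\<^sub>R F_mu x"
proof -
  have "W x * f (fst x) - \<epsilon> * p * f (fst x)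
      = (real p + real q) * f (fst x) * g (fst x) * g (fst x)"
    "W x * g (fst x) + \<epsilon> * q * g (fst x)
      = (real p + real q) * f (fst x) * g (fst x) * f (fst x)"
    unfolding W_def hyperbola[of "fst x", symmetric]
    by (simp_all add: power2_eq_square algebra_simps)
  note coords = this[THEN arg_cong[where f = complex_of_real]]
  have "W x *\<^sub>R F x + \<epsilon> *\<^sub>R cplx_J (F_theta x) =
      (sqrt q * cis (p * snd x) * of_real (W x * f (fst x) - \<epsilon> * p * f (fst x)),
       \<i> * sqrt p * cis (- real q * snd x) * of_real (W x * g (fst x) + \<epsilon> * q * g (fst x)))"
    by (simp add: F_def F_theta_def wave_def cplx_J_def scaleR_conv_of_real algebra_simps)
  also have "\<dots> = ((real p + real q) * f (fst x) * g (fst x)) *\<^sub>R F_mu x"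
    unfolding coords F_mu_def wave_def
    by (simp add: scaleR_conv_of_real algebra_simps)
  finally show ?thesis .
qed

lemma normal_proj_position: "normal_proj F x (F x) = (- \<epsilon> / W x) *\<^sub>R cplx_J (F_theta x)"
proof (rule normal_proj_eqI[OF F_differentiable])
  have "cplx_J (F_theta x) \<bullet> F_theta x = 0"
    by (simp add: cplx_J_def inner_prod_def inner_complex_def)
  moreover have "cplx_J (F_theta x) \<bullet> F_mu x = 0"
    using symp_form_F[of x "(0, 1)" "(1, 0)"]
    by (simp add: frechet_derivative_F symp_form_eq_inner)
  ultimately have "F_theta x \<bullet> cplx_J (F_theta x) = 0" "F_mu x \<bullet> cplx_J (F_theta x) = 0"
    by (simp_all add: inner_commute)
  then show "(- \<epsilon> / W x) *\<^sub>R cplx_J (F_theta x) \<in> orthogonal_comp (tangent_plane F x)"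
    by (auto simp: orthogonal_comp_def orthogonal_def tangent_plane_def frechet_derivative_F
        inner_add_left inner_add_right)
next
  let ?k = "(real p + real q) * f (fst x) * g (fst x) / W x"
  have "F x - (- \<epsilon> / W x) *\<^sub>R cplx_J (F_theta x)
      = (1 / W x) *\<^sub>R (W x *\<^sub>R F x + \<epsilon> *\<^sub>R cplx_J (F_theta x))"
    using W_pos[of x] by (simp add: scaleR_add_right)
  also have "\<dots> = frechet_derivative F (at x) (?k, 0)"
    unfolding position_decomposition by (simp add: frechet_derivative_F)
  finally show "F x - (- \<epsilon> / W x) *\<^sub>R cplx_J (F_theta x) \<in> tangent_plane F x"
    unfolding tangent_plane_def by blast
qed

lemma normal_proj_eq_mean_curvature:
  assumes "p \<noteq> q" and "c = (real p * real q) / (2 * (real p - real q))"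
  shows "normal_proj F x (F x) = (2 * (- \<epsilon> * c)) *\<^sub>R mean_curvature F x"
proof -
  have "2 * (- \<epsilon> * c) * ((real p - real q) / (real p * real q * W x)) = - \<epsilon> / W x"
    using assms W_pos[of x] p_pos q_pos by (simp add: field_simps)
  then show ?thesis
    unfolding normal_proj_position mean_curvature_F scaleR_scaleR by simp
qed

end

theorem proposition2p1:
  fixes p q :: nat and c :: real and S E :: "real \<times> real \<Rightarrow> complex \<times> complex"
  assumes "0 < q" and "q < p" and "coprime p q"
    and "c = (real p * real q) / (2 * (real p - real q))"
    and "\<And>\<mu> \<theta>. S (\<mu>, \<theta>) =
      (of_real (cosh \<mu>) * of_real (sqrt (real q)) * exp (\<i> * of_real (real p * \<theta>)),
       \<i> * of_real (sinh \<mu>) * of_real (sqrt (real p)) * exp (- \<i> * of_real (real q * \<theta>)))"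
    and "\<And>\<mu> \<theta>. E (\<mu>, \<theta>) =
      (of_real (sinh \<mu>) * of_real (sqrt (real q)) * exp (\<i> * of_real (real p * \<theta>)),
       \<i> * of_real (cosh \<mu>) * of_real (sqrt (real p)) * exp (- \<i> * of_real (real q * \<theta>)))"
  shows "(hamiltonian_stationary S \<and> self_shrinker S)
    \<and> (hamiltonian_stationary E \<and> self_expander E)
    \<and> (\<forall>x. normal_proj S x (S x) = (- (2 * c)) *\<^sub>R mean_curvature S x)
    \<and> (\<forall>x. normal_proj E x (E x) = (2 * c) *\<^sub>R mean_curvature E x)"
proof -
  interpret S: hyperbolic_cylinder p q cosh sinh 1
    using assms(1,2)
    by unfold_locales (auto intro!: derivative_eq_intros simp: cosh_square_eq)
  interpret E: hyperbolic_cylinder p q sinh cosh "-1"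
    using assms(1,2)
    by unfold_locales (auto intro!: derivative_eq_intros simp: cosh_square_eq)
  have "S = S.F"
  proof
    fix x show "S x = S.F x"
      using assms(5)[of "fst x" "snd x"]
      by (simp add: S.F_def S.wave_def cis_conv_exp mult_ac)
  qed
  have "E = E.F"
  proof
    fix x show "E x = E.F x"
      using assms(6)[of "fst x" "snd x"]
      by (simp add: E.F_def E.wave_def cis_conv_exp mult_ac)
  qed
  have "p \<noteq> q" and "0 < c"
    using assms(1,2,4) by auto
  have S_normal: "normal_proj S x (S x) = (2 * (- c)) *\<^sub>R mean_curvature S x" for x
    using S.normal_proj_eq_mean_curvature[OF \<open>p \<noteq> q\<close> assms(4)] by (simp add: \<open>S = S.F\<close>)
  have E_normal: "normal_proj E x (E x) = (2 * c) *\<^sub>R mean_curvature E x" for x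
    using E.normal_proj_eq_mean_curvature[OF \<open>p \<noteq> q\<close> assms(4)] by (simp add: \<open>E = E.F\<close>)
  have "self_similar S (- c)" "self_similar E c"
    unfolding self_similar_def
    using S_normal E_normal S.lagrangian_F E.lagrangian_F \<open>S = S.F\<close> \<open>E = E.F\<close> by auto
  then have "self_shrinker S" "self_expander E"
    unfolding self_shrinker_def self_expander_def using \<open>0 < c\<close> by (meson neg_less_0_iff_less)+
  then show ?thesis
    using S_normal E_normal S.hamiltonian_stationary_F E.hamiltonian_stationary_F
      \<open>S = S.F\<close> \<open>E = E.F\<close> by simp
qed

end
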